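(* Let $\xi\in\left(0,\frac1{n_x}\min\left\{\frac1{\kappa_{\mathrm{tr}_1}},\frac{\min_{j\in[n_x]}(x_{U,j}-x_{L,j})}{2\Delta_{\max}}\right\}\right]$. Suppose that the procedure \textsc{SelectPoints}, possibly followed by iterative calls to the procedure \textsc{AddDirection} (both described in the context), yields a set $\mathcal{D}_k=\{0,d_1,\dots,d_{n_x}\}$ with $|\mathcal{D}_k|=n_x+1$. Then the matrix $[d_1\ \cdots\ d_{n_x}]$ is invertible and $$\left\|\begin{bmatrix}d_1&\cdots&d_{n_x}\end{bmatrix}^{-1}\right\|_2\le\frac{\Lambda}{\Delta_k}\qquad\text{with}\qquad \Lambda=\frac{n_x^{\frac{n_x-1}{2}}\kappa_{\mathrm{tr}_0}^{n_x-1}}{\xi^{n_x}} .$$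
   Context: Setting. $\Omega=[x_L,x_U]\subseteq\mathbb{R}^{n_x}$ with $x_L\in(\mathbb{R}\cup\{-\infty\})^{n_x}$, $x_U\in(\mathbb{R}\cup\{\infty\})^{n_x}$, $x_{L,j}<x_{U,j}$ for all $j$; $x_k\in\Omega$; $0<\Delta_k\le\Delta_{\max}<\infty$; $\mathrm{tr}\ge1$ is real, $\|\cdot\|_{\mathrm{tr}}$ is the $\ell_{\mathrm{tr}}$-norm with closed balls $B_{\mathrm{tr}}(x,\Delta)$; $\kappa_{\mathrm{tr}_0},\kappa_{\mathrm{tr}_1}>0$ are constants with $\|v\|_2\le\kappa_{\mathrm{tr}_0}\|v\|_{\mathrm{tr}}$ and $\|v\|_{\mathrm{tr}}\le\kappa_{\mathrm{tr}_1}\|v\|_2$ for all $v\in\mathbb{R}^{n_x}$. $[n]=\{1,\dots,n\}$. For $Z$ with orthonormal columns, $\mathrm{proj}_Z$ is the orthogonal projection onto its column space and $\Upsilon(Z,d)=\|Z^Td\|_2^2$. \textsc{SelectPoints}: start with $\mathcal{D}_k=\{0\}$, $Z=I_{n_x}$ and a finite ordered candidate set $\mathcal{C}=\{x^{(1)},\dots,x^{(|\mathcal{C}|)}\}\subseteq B_{\mathrm{tr}}(x_k,\Delta_k)\cap\Omega$. For $j=1,\dots,|\mathcal{C}|$: if $\|\mathrm{proj}_Z((x^{(j)}-x_k)/\Delta_k)\|_2\ge\xi$, add $x^{(j)}-x_k$ to $\mathcal{D}_k$ and replace $Z$ by a matrix with orthonormal columns spanning the orthogonal complement of $\mathrm{span}(\mathcal{D}_k)$.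 Return $(\mathcal{D}_k,Z)$. For $v\in\mathbb{R}^{n_x}$ define $\bar\tau(v)\in[0,\infty]^{n_x}$ by $\bar\tau_j(v)=(x_{U,j}-x_{k,j})/v_j$ if $v_j>0$ and $x_{U,j}<\infty$; $\bar\tau_j(v)=(x_{L,j}-x_{k,j})/v_j$ if $v_j<0$ and $x_{L,j}>-\infty$; $\bar\tau_j(v)=\infty$ otherwise. For $\tau\in[0,\infty]$ let $d(v,\tau)$ have components $\min\{\tau,\bar\tau_j(v)\}v_j$. Conventions: $0\times\infty=0$, $\pm a\times\infty=\pm\infty$ for $a>0$, and a vector with an infinite component has norm $\infty$. \textsc{OptStep}$(Z,v,\bar\tau)$ with $\bar\tau=\bar\tau(v)$: put $\bar\tau_{(0)}=0$ and sort the distinct positive values among $\bar\tau_1,\dots,\bar\tau_{n_x}$ as $0<\bar\tau_{(1)}<\dots<\bar\tau_{(\hat n_x)}$ (if there are none, $\hat n_x=0$ and $0$ is returned). If $\|d(v,\bar\tau_{(\hat n_x)})\|_{\mathrm{tr}}\le\Delta_k$, return a maximizer of $\Upsilon(Z,d(v,\tau))$ over $\tau\in\{\bar\tau_{(1)},\dots,\bar\tau_{(\hat n_x)}\}$. Otherwise find $\hat j\in[\hat n_x]$ with $\|d(v,\bar\tau_{(\hat j-1)})\|_{\mathrm{tr}}\le\Delta_k\le\|d(v,\bar\tau_{(\hat j)})\|_{\mathrm{tr}}$, find $\hat\tau\in[\bar\tau_{(\hat j-1)},\bar\tau_{(\hat j)}]$ with $\|d(v,\hat\tau)\|_{\mathrm{tr}}=\Delta_k$,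 and return a maximizer of $\Upsilon(Z,d(v,\tau))$ over $\tau\in\{\bar\tau_{(1)},\dots,\bar\tau_{(\hat j-1)}\}\cup\{\hat\tau\}$. \textsc{AddDirection}$(\mathcal{D}_k,Z)$, called when $|\mathcal{D}_k|<n_x+1$, with $Z=[z_1\cdots z_{n_z}]$: set $d\leftarrow0$. For $i=1,\dots,n_z$: compute $\tau^+\leftarrow$\textsc{OptStep}$(Z,z_i,\bar\tau(z_i))$ and, if $\Upsilon(Z,d(z_i,\tau^+))>\Upsilon(Z,d)$, set $d\leftarrow d(z_i,\tau^+)$; compute $\tau^-\leftarrow$\textsc{OptStep}$(Z,-z_i,\bar\tau(-z_i))$ and, if $\Upsilon(Z,d(-z_i,\tau^-))>\Upsilon(Z,d)$, set $d\leftarrow d(-z_i,\tau^-)$. Add $d$ to $\mathcal{D}_k$, replace $Z$ by a matrix with orthonormal columns spanning the orthogonal complement of $\mathrm{span}(\mathcal{D}_k)$, and return $(\mathcal{D}_k,Z)$. *)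

theory Defs
  imports "HOL-Analysis.Analysis"
begin

text \<open>The coordinates of $\mathbb{R}^{n_x}$ are indexed by a finite type \<open>'n\<close>, so $n_x$ is \<open>CARD('n)\<close>.\<close>

definition ltr_norm :: "real \<Rightarrow> real ^ 'n \<Rightarrow> real" where
  "ltr_norm tr v = (\<Sum>j\<in>UNIV. \<bar>v $ j\<bar> powr tr) powr (1 / tr)"

definition ltr_cball :: "real \<Rightarrow> real ^ 'n \<Rightarrow> real \<Rightarrow> (real ^ 'n) set" where
  "ltr_cball tr x r = {y. ltr_norm tr (y - x) \<le> r}"

definition feasible_box :: "ereal ^ 'n \<Rightarrow> ereal ^ 'n \<Rightarrow> (real ^ 'n) set" where
  "feasible_box xL xU = {x. \<forall>j. xL $ j \<le> ereal (x $ j) \<and> ereal (x $ j) \<le> xU $ j}"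

text \<open>
  A matrix $Z = [z_1 \cdots z_{n_z}]$ whose number of columns varies is represented by the list of
  its columns; the empty list is the $n_x \times 0$ matrix.
\<close>

definition orthonormal_columns :: "(real ^ 'n) list \<Rightarrow> bool" where
  "orthonormal_columns Z \<longleftrightarrow>
     (\<forall>i<length Z. \<forall>j<length Z. Z ! i \<bullet> Z ! j = (if i = j then 1 else 0))"

definition orth_proj :: "(real ^ 'n) set \<Rightarrow> real ^ 'n \<Rightarrow> real ^ 'n" where
  "orth_proj S x = (THE p. p \<in> S \<and> x - p \<in> S\<^sup>\<bottom>)"

text \<open>The definite description above is meaningful on every subspace.\<close>

lemma orth_proj_ex1:
  fixes S :: "(real ^ 'n) set"
  assumes "subspace S"
  shows "\<exists>!p. p \<in> S \<and> x - p \<in> S\<^sup>\<bottom>"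
proof -
  have "x \<in> S + S\<^sup>\<bottom>"
    using subspace_sum_orthogonal_comp[OF assms] by simp
  then obtain p q where pq: "p \<in> S" "q \<in> S\<^sup>\<bottom>" "x = p + q"
    by (auto elim: set_plus_elim)
  show ?thesis
  proof (rule ex1I[of _ p])
    show "p \<in> S \<and> x - p \<in> S\<^sup>\<bottom>" using pq by simp
    fix r assume r: "r \<in> S \<and> x - r \<in> S\<^sup>\<bottom>"
    have "(x - p) - (x - r) \<in> S\<^sup>\<bottom>"
      by (rule subspace_diff[OF subspace_orthogonal_comp]) (use pq r in auto)
    moreover have "r - p \<in> S" using pq r assms by (auto intro: subspace_diff)
    ultimately have "orthogonal (r - p) (r - p)"
      by (simp add: orthogonal_comp_def)
    then show "r = p" by (simp add: orthogonal_def)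
  qed
qed

abbreviation proj_cols :: "(real ^ 'n) list \<Rightarrow> real ^ 'n \<Rightarrow> real ^ 'n" where
  "proj_cols Z \<equiv> orth_proj (span (set Z))"

text \<open>$\Upsilon(Z,d) = \|Z^T d\|_2^2$; the entries of $Z^T d$ are the inner products of $d$ with the columns.\<close>

definition Upsilon :: "(real ^ 'n) list \<Rightarrow> real ^ 'n \<Rightarrow> real" where
  "Upsilon Z d = (\<Sum>z\<leftarrow>Z. (z \<bullet> d)\<^sup>2)"

definition complement_basis :: "(real ^ 'n) set \<Rightarrow> (real ^ 'n) list \<Rightarrow> bool" where
  "complement_basis D Z \<longleftrightarrow> orthonormal_columns Z \<and> span (set Z) = (span D)\<^sup>\<bottom>"

text \<open>
  The procedures leave choices open (the basis matrix, the maximizer, $\hat j$, $\hat\tau$), so they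
  are relations between inputs and possible outputs.
\<close>

fun select_loop ::
  "real ^ 'n \<Rightarrow> real \<Rightarrow> real \<Rightarrow> (real ^ 'n) list \<Rightarrow>
   (real ^ 'n) set \<times> (real ^ 'n) list \<Rightarrow> (real ^ 'n) set \<times> (real ^ 'n) list \<Rightarrow> bool" where
  "select_loop xk \<Delta> \<xi> [] (D, Z) out \<longleftrightarrow> out = (D, Z)"
| "select_loop xk \<Delta> \<xi> (x # xs) (D, Z) out \<longleftrightarrow>
     (if norm (proj_cols Z ((x - xk) /\<^sub>R \<Delta>)) \<ge> \<xi>
      then \<exists>Z'. complement_basis (insert (x - xk) D) Z' \<and>
                select_loop xk \<Delta> \<xi> xs (insert (x - xk) D, Z') out
      else select_loop xk \<Delta> \<xi> xs (D, Z) out)"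

text \<open>
  The initial $Z$ is the identity matrix. As \<open>'n\<close> carries no order, its columns (the unit
  vectors) may be listed in any order \<open>js\<close> of the coordinates.
\<close>

definition select_points ::
  "real ^ 'n \<Rightarrow> real \<Rightarrow> real \<Rightarrow> (real ^ 'n) list \<Rightarrow> (real ^ 'n) set \<times> (real ^ 'n) list \<Rightarrow> bool" where
  "select_points xk \<Delta> \<xi> C out \<longleftrightarrow>
     (\<exists>js :: 'n list. distinct js \<and> set js = UNIV \<and>
        select_loop xk \<Delta> \<xi> C ({0}, map (\<lambda>j. axis j 1) js) out)"

definition taubar :: "ereal ^ 'n \<Rightarrow> ereal ^ 'n \<Rightarrow> real ^ 'n \<Rightarrow> real ^ 'n \<Rightarrow> ereal ^ 'n" where
  "taubar xL xU xk v = (\<chi> j.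
     if v $ j > 0 \<and> xU $ j < \<infinity> then (xU $ j - ereal (xk $ j)) / ereal (v $ j)
     else if v $ j < 0 \<and> xL $ j > -\<infinity> then (xL $ j - ereal (xk $ j)) / ereal (v $ j)
     else \<infinity>)"

text \<open>
  $d(v,\tau)$ may have infinite components. Multiplication on \<^typ>\<open>ereal\<close> satisfies
  $0 \cdot \infty = 0$ and $\pm a \cdot \infty = \pm\infty$ for $a > 0$.
\<close>

definition step_dir :: "ereal ^ 'n \<Rightarrow> real ^ 'n \<Rightarrow> ereal \<Rightarrow> ereal ^ 'n" where
  "step_dir tb v \<tau> = (\<chi> j. min \<tau> (tb $ j) * ereal (v $ j))"

definition real_vec :: "ereal ^ 'n \<Rightarrow> real ^ 'n" where
  "real_vec w = (\<chi> j. real_of_ereal (w $ j))"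

definition ltr_enorm :: "real \<Rightarrow> ereal ^ 'n \<Rightarrow> ereal" where
  "ltr_enorm tr w =
     (if \<exists>j. \<bar>w $ j\<bar> = \<infinity> then \<infinity> else ereal (ltr_norm tr (real_vec w)))"

text \<open>
  \<open>breakpoints tb\<close> is the list $[\bar\tau_{(0)}, \bar\tau_{(1)}, \dots, \bar\tau_{(\hat n_x)}]$ with
  $\bar\tau_{(0)} = 0$; the last entry may be $\infty$.
\<close>

definition breakpoints :: "ereal ^ 'n \<Rightarrow> ereal list" where
  "breakpoints tb = 0 # sorted_list_of_set {t \<in> range (($) tb). 0 < t}"

text \<open>
  \<^const>\<open>Upsilon\<close> is only compared below at vectors $d(v,\tau)$ of norm at most $\Delta$,
  which are finite, so \<^const>\<open>real_vec\<close> loses nothing there.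
\<close>

definition opt_step ::
  "real \<Rightarrow> real \<Rightarrow> (real ^ 'n) list \<Rightarrow> real ^ 'n \<Rightarrow> ereal ^ 'n \<Rightarrow> ereal \<Rightarrow> bool" where
  "opt_step tr \<Delta> Z v tb \<tau> \<longleftrightarrow>
     (let t = (\<lambda>i. breakpoints tb ! i);
          n = length (breakpoints tb) - 1;
          maximizer_on = (\<lambda>T. is_arg_max (\<lambda>s. Upsilon Z (real_vec (step_dir tb v s))) (\<lambda>s. s \<in> T) \<tau>)
      in if n = 0 then \<tau> = 0
         else if ltr_enorm tr (step_dir tb v (t n)) \<le> ereal \<Delta> then maximizer_on (t ` {1..n})
         else \<exists>j\<in>{1..n}. \<exists>\<tau>'\<in>{t (j - 1)..t j}.
                ltr_enorm tr (step_dir tb v (t (j - 1))) \<le> ereal \<Delta> \<and>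
                ereal \<Delta> \<le> ltr_enorm tr (step_dir tb v (t j)) \<and>
                ltr_enorm tr (step_dir tb v \<tau>') = ereal \<Delta> \<and>
                maximizer_on (t ` {1..j - 1} \<union> {\<tau>'}))"

definition try_direction ::
  "ereal ^ 'n \<Rightarrow> ereal ^ 'n \<Rightarrow> real ^ 'n \<Rightarrow> real \<Rightarrow> real \<Rightarrow> (real ^ 'n) list \<Rightarrow>
   real ^ 'n \<Rightarrow> real ^ 'n \<Rightarrow> real ^ 'n \<Rightarrow> bool" where
  "try_direction xL xU xk tr \<Delta> Z v d d' \<longleftrightarrow>
     (\<exists>\<tau>. opt_step tr \<Delta> Z v (taubar xL xU xk v) \<tau> \<and>
        (let e = real_vec (step_dir (taubar xL xU xk v) v \<tau>)
         in d' = (if Upsilon Z e > Upsilon Z d then e else d)))"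

text \<open>The second list argument holds the columns $z_i$ of \<open>Z\<close> still to be processed.\<close>

fun direction_loop ::
  "ereal ^ 'n \<Rightarrow> ereal ^ 'n \<Rightarrow> real ^ 'n \<Rightarrow> real \<Rightarrow> real \<Rightarrow> (real ^ 'n) list \<Rightarrow>
   (real ^ 'n) list \<Rightarrow> real ^ 'n \<Rightarrow> real ^ 'n \<Rightarrow> bool" where
  "direction_loop xL xU xk tr \<Delta> Z [] d d' \<longleftrightarrow> d' = d"
| "direction_loop xL xU xk tr \<Delta> Z (z # zs) d d' \<longleftrightarrow>
     (\<exists>d1 d2. try_direction xL xU xk tr \<Delta> Z z d d1 \<and>
              try_direction xL xU xk tr \<Delta> Z (- z) d1 d2 \<and>
              direction_loop xL xU xk tr \<Delta> Z zs d2 d')"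

fun add_direction ::
  "ereal ^ 'n \<Rightarrow> ereal ^ 'n \<Rightarrow> real ^ 'n \<Rightarrow> real \<Rightarrow> real \<Rightarrow>
   (real ^ 'n) set \<times> (real ^ 'n) list \<Rightarrow> (real ^ 'n) set \<times> (real ^ 'n) list \<Rightarrow> bool" where
  "add_direction xL xU xk tr \<Delta> (D, Z) (D', Z') \<longleftrightarrow>
     card D < CARD('n) + 1 \<and>
     (\<exists>d. direction_loop xL xU xk tr \<Delta> Z Z 0 d \<and> D' = insert d D \<and> complement_basis D' Z')"

end

theory Submission
  imports Defs
begin

text \<open>Every vector added by either procedure has norm at most $\kappa_{\mathrm{tr}_0}\Delta_k$ and
  distance at least $\xi\Delta_k$ from the span of its predecessors. For \<open>SelectPoints\<close> this is the
  acceptance test. For \<open>AddDirection\<close>, take a unit column $z$ of $Z$ and a coordinate $j$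
  with $z_j^2 \ge 1/n_x$: along $z$ or $-z$ one can move coordinate $j$ by half the width of the box,
  so the step is stopped either by the trust region or after a substantial move in coordinate $j$,
  and in both cases its inner product with the direction is at least $\xi\Delta_k$.

  Gram-Schmidt then gives $|\det A| \ge (\xi\Delta_k)^{n_x}$. For a unit vector $x$ complete $x$ to
  an orthogonal matrix $Q$; Hadamard's inequality for $AQ$ reads
  $|\det A| \le \|Ax\|\,\|A\|^{n_x-1}$, and
  $\|A\| \le \sqrt{n_x}\,\kappa_{\mathrm{tr}_0}\Delta_k$, which bounds $\|Ax\|$ from below.\<close>

section \<open>Determinants: Gram-Schmidt residuals and Hadamard's inequality\<close>

text \<open>Each residual \<open>r i\<close> arises from row \<open>a i\<close> by adding a
  combination of earlier rows, so the determinant survives the exchange. The residuals are mutually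
  orthogonal, so their Gram matrix is diagonal. The injection \<open>f\<close> supplies the order
  that the index type lacks.\<close>

lemma abs_det_eq_prod_norm:
  fixes a r :: "'n::finite \<Rightarrow> real ^ 'n" and f :: "'n \<Rightarrow> nat"
  assumes "inj f"
    and span: "\<And>i. a i - r i \<in> span (a ` {l. f l < f i})"
    and orth: "\<And>i l. f l < f i \<Longrightarrow> orthogonal (r i) (a l)"
  shows "\<bar>det (\<chi> i. a i)\<bar> = (\<Prod>i\<in>UNIV. norm (r i))"
proof -
  \<comment> \<open>Rows are exchanged from the largest value of \<open>f\<close> downwards: when
    row \<open>m\<close> with \<open>f m = k\<close> is treated, all rows of smaller value are still
    the original ones, so the correction lies in their span.\<close>
  have det_step: "det (\<chi> i. if f i \<ge> k then r i else a i) = det (\<chi> i. if f i \<ge> Suc k then r i else a i)" for k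
  proof (cases "k \<in> range f")
    case True
    then obtain m where m: "f m = k" by auto
    let ?A = "(\<chi> i. if f i \<ge> Suc k then r i else a i) :: real^'n^'n"
    have sub: "a ` {l. f l < f m} \<subseteq> {row j ?A |j. j \<noteq> m}"
    proof
      fix y assume "y \<in> a ` {l. f l < f m}"
      then obtain l where l: "f l < k" "y = a l" using m by auto
      have "y = row l ?A" using l by (simp add: row_def vec_eq_iff)
      moreover have "l \<noteq> m" using l m by auto
      ultimately show "y \<in> {row j ?A |j. j \<noteq> m}" by blast
    qed
    have "- (a m - r m) \<in> span {row j ?A |j. j \<noteq> m}"
      using span_mono[OF sub] span[of m] by (blast intro: span_neg)
    then have "det (\<chi> k. if k = m then row m ?A + (- (a m - r m)) else row k ?A) = det ?A"
      by (intro det_row_span) (simp add: span_vec_eq)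
    moreover have "(\<chi> k. if k = m then row m ?A + (- (a m - r m)) else row k ?A) =
      (\<chi> i. if f i \<ge> k then r i else a i)"
      using m inj_eq[OF \<open>inj f\<close>] by (auto simp: row_def vec_eq_iff Suc_le_eq order.order_iff_strict)
    ultimately show ?thesis by simp
  next
    case False
    then have "f i \<ge> k \<longleftrightarrow> f i \<ge> Suc k" for i
      by (metis Suc_le_eq order.order_iff_strict rangeI)
    then show ?thesis by simp
  qed
  \<comment> \<open>The interpolating matrix consists of residuals only at \<open>k = 0\<close> and
    of original rows only at \<open>k = N\<close>.\<close>
  obtain N where N: "\<And>i. f i < N"
    using finite_nat_set_iff_bounded[of "range f"] by auto
  have "det (\<chi> i. if f i \<ge> k then r i else a i) = det (\<chi> i. r i)" for k
    by (induction k) (simp_all add: det_step[symmetric])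
  from this[of N] have det_eq: "det (\<chi> i. a i) = det (\<chi> i. r i)"
    using N by (simp add: not_le[symmetric])
  have orth_less: "r i \<bullet> r l = 0" if "f l < f i" for i l
  proof -
    have "orthogonal (r i) (a l - r l)"
      by (rule orthogonal_to_span[OF span[of l]]) (use orth that in force)
    with orth[OF that] show ?thesis by (simp add: orthogonal_def inner_diff_right)
  qed
  have orth_r: "r i \<bullet> r l = 0" if "i \<noteq> l" for i l
    using that orth_less[of l i] orth_less[of i l] inj_eq[OF \<open>inj f\<close>, of i l]
    by (metis inner_commute linorder_neqE_nat)
  let ?R = "(\<chi> i. r i) :: real^'n^'n"
  have RR: "(?R ** transpose ?R) $ i $ l = r i \<bullet> r l" for i l
    by (simp add: matrix_matrix_mult_def transpose_def inner_vec_def)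
  have "(det ?R)\<^sup>2 = det (?R ** transpose ?R)"
    by (simp add: det_mul power2_eq_square)
  also have "\<dots> = (\<Prod>i\<in>UNIV. r i \<bullet> r i)"
    by (subst det_diagonal) (simp_all add: RR orth_r)
  also have "\<dots> = (\<Prod>i\<in>UNIV. norm (r i))\<^sup>2"
    by (simp add: power2_norm_eq_inner[symmetric] prod_power_distrib)
  finally have "\<bar>det ?R\<bar> = \<bar>\<Prod>i\<in>UNIV. norm (r i)\<bar>"
    by (simp add: power2_eq_iff abs_eq_iff)
  then show ?thesis by (simp add: det_eq prod_nonneg)
qed

text \<open>\<open>r i\<close> is the component of \<open>a i\<close> orthogonal to the span of its
  predecessors, so Pythagoras bounds its norm. All residuals are chosen at once, since each is
  defined by the original rows.\<close>

lemma gram_schmidt_residuals: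
  fixes a :: "'n::finite \<Rightarrow> real ^ 'n" and f :: "'n \<Rightarrow> nat"
  assumes "inj f"
  obtains r where "\<And>i. a i - r i \<in> span (a ` {l. f l < f i})"
    and "\<And>i. norm (r i) \<le> norm (a i)"
    and "\<bar>det (\<chi> i. a i)\<bar> = (\<Prod>i\<in>UNIV. norm (r i))"
proof -
  have "\<exists>r. a i - r \<in> span (a ` {l. f l < f i}) \<and> (\<forall>w\<in>span (a ` {l. f l < f i}). orthogonal r w)" for i
  proof -
    obtain y z where "y \<in> span (a ` {l. f l < f i})"
      "\<And>w. w \<in> span (a ` {l. f l < f i}) \<Longrightarrow> orthogonal z w" "a i = y + z"
      using orthogonal_subspace_decomp_exists[of "a ` {l. f l < f i}" "a i"] by blast
    then show ?thesis by (intro exI[of _ z]) simp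
  qed
  then obtain r where r: "\<And>i. a i - r i \<in> span (a ` {l. f l < f i})"
    and orth: "\<And>i w. w \<in> span (a ` {l. f l < f i}) \<Longrightarrow> orthogonal (r i) w"
    by metis
  have "norm (r i) \<le> norm (a i)" for i
  proof -
    have "(norm (r i + (a i - r i)))\<^sup>2 = (norm (r i))\<^sup>2 + (norm (a i - r i))\<^sup>2"
      by (rule norm_add_Pythagorean) (rule orth[OF r])
    then show ?thesis by (simp add: power2_le_imp_le)
  qed
  moreover have "\<bar>det (\<chi> i. a i)\<bar> = (\<Prod>i\<in>UNIV. norm (r i))"
    by (rule abs_det_eq_prod_norm[OF assms r]) (simp add: orth span_base)
  ultimately show ?thesis using that r by blast
qed

lemma hadamard_inequality:
  fixes a :: "'n::finite \<Rightarrow> real ^ 'n"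
  shows "\<bar>det (\<chi> i. a i)\<bar> \<le> (\<Prod>i\<in>UNIV. norm (a i))"
proof -
  obtain f :: "'n \<Rightarrow> nat" where "inj f"
    using finite_imp_inj_to_nat_seg[of "UNIV :: 'n set"] by auto
  from gram_schmidt_residuals[OF this, of a] show ?thesis
    by (metis (no_types, lifting) norm_ge_zero prod_mono)
qed

text \<open>Each residual has the form \<open>a i - p\<close> with \<open>p\<close> in the span of
  the predecessors, so every factor of the determinant is at least \<open>c\<close>.\<close>

lemma abs_det_ge_power:
  fixes a :: "'n::finite \<Rightarrow> real ^ 'n" and f :: "'n \<Rightarrow> nat"
  assumes "inj f" "0 \<le> c"
    and far: "\<And>i p. p \<in> span (a ` {l. f l < f i}) \<Longrightarrow> c \<le> norm (a i - p)"
  shows "c ^ CARD('n) \<le> \<bar>det (\<chi> i. a i)\<bar>"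
proof -
  obtain r where r: "\<And>i. a i - r i \<in> span (a ` {l. f l < f i})"
    and det: "\<bar>det (\<chi> i. a i)\<bar> = (\<Prod>i\<in>UNIV. norm (r i))"
    using gram_schmidt_residuals[OF \<open>inj f\<close>, of a] by metis
  have "c \<le> norm (r i)" for i
    using far[OF r[of i]] by simp
  then have "(\<Prod>i\<in>(UNIV::'n set). c) \<le> (\<Prod>i\<in>UNIV. norm (r i))"
    by (intro prod_mono) (use \<open>0 \<le> c\<close> in auto)
  then show ?thesis by (simp add: det)
qed

section \<open>From determinant bounds to a bound on the inverse\<close>

text \<open>The triangle inequality over the columns brings in the sum of the absolute entries of
  \<open>x\<close>; Cauchy-Schwarz turns it into \<open>norm x\<close> at the cost of the square
  root of the dimension.\<close>

lemma norm_matrix_vector_le_columns: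
  fixes M :: "real ^ 'n ^ 'm"
  assumes "\<And>j. norm (column j M) \<le> b" 
  shows "norm (M *v x) \<le> sqrt (real CARD('n)) * b * norm x"
proof -
  have "0 \<le> b" using assms norm_ge_zero order_trans by blast
  have "norm (M *v x) \<le> (\<Sum>j\<in>UNIV. norm (x $ j *s column j M))"
    by (simp only: matrix_mult_sum norm_sum)
  also have "\<dots> \<le> (\<Sum>j\<in>UNIV. \<bar>x $ j\<bar> * b)"
    by (intro sum_mono) (simp add: scalar_mult_eq_scaleR assms mult_left_mono)
  also have "\<dots> = (\<Sum>j\<in>UNIV. \<bar>x $ j\<bar>) * b" by (simp add: sum_distrib_right)
  also have "(\<Sum>j\<in>UNIV. \<bar>x $ j\<bar>) \<le> sqrt (real CARD('n)) * norm x"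
  proof (rule power2_le_imp_le)
    have "(\<Sum>j\<in>UNIV. \<bar>x $ j\<bar>)\<^sup>2 \<le> (\<Sum>j\<in>UNIV. \<bar>x $ j\<bar>\<^sup>2) * real CARD('n)"
      using sum_squared_le_sum_of_squares[of "\<lambda>j. \<bar>x $ j\<bar>" UNIV] by simp
    also have "(\<Sum>j\<in>UNIV. \<bar>x $ j\<bar>\<^sup>2) = (norm x)\<^sup>2"
      unfolding norm_vec_def L2_set_def by (subst real_sqrt_pow2) (auto intro: sum_nonneg)
    finally show "(\<Sum>j\<in>UNIV. \<bar>x $ j\<bar>)\<^sup>2 \<le> (sqrt (real CARD('n)) * norm x)\<^sup>2"
      by (simp add: power_mult_distrib mult.commute)
  qed simp
  finally show ?thesis using \<open>0 \<le> b\<close> by (simp add: mult_right_mono mult_ac)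
qed

text \<open>In other terms, the smallest singular value is at least the absolute determinant divided
  by the power of \<open>K\<close>.\<close>

lemma norm_matrix_vector_ge_det:
  fixes A :: "real ^ 'n ^ 'n"
  assumes bound: "\<And>x. norm (A *v x) \<le> K * norm x"
  shows "\<bar>det A\<bar> * norm x \<le> K ^ (CARD('n) - 1) * norm (A *v x)"
proof (cases "x = 0")
  case False
  define u where "u = x /\<^sub>R norm x"
  have "norm u = 1" using False by (simp add: u_def)
  fix k :: 'n
  obtain Q :: "real^'n^'n" where Q: "orthogonal_matrix Q" "Q *v axis k 1 = u"
    using orthogonal_matrix_exists_basis[OF \<open>norm u = 1\<close>] by metis
  have col: "column j (A ** Q) = A *v (Q *v axis j 1)" for j
    by (simp add: matrix_vector_mul_assoc flip: matrix_vector_mult_basis)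
  have normQ: "norm (Q *v axis j 1) = 1" for j
    using Q(1) by (metis norm_axis_1 orthogonal_transformation_matrix 
       matrix_of_matrix_vector_mul matrix_vector_mul_linear orthogonal_transformation_norm)
  \<comment> \<open>Transposed, because \<open>hadamard_inequality\<close> speaks of rows while the
    images under \<open>A\<close> are columns.\<close>
  have "\<bar>det A\<bar> = \<bar>det (transpose (A ** Q))\<bar>"
    using det_orthogonal_matrix[OF Q(1)] by (auto simp: det_mul)
  also have "transpose (A ** Q) = (\<chi> j. column j (A ** Q))"
    by (simp add: transpose_def column_def)
  also have "\<bar>det (\<chi> j. column j (A ** Q))\<bar> \<le> (\<Prod>j\<in>UNIV. norm (column j (A ** Q)))"
    by (rule hadamard_inequality)
  also have "\<dots> = norm (A *v u) * (\<Prod>j\<in>UNIV - {k}. norm (column j (A ** Q)))"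
    using prod.remove[of UNIV k "\<lambda>j. norm (column j (A ** Q))"] by (simp add: col Q)
  \<comment> \<open>The columns other than \<open>k\<close> are images of unit vectors.\<close>
  also have "\<dots> \<le> norm (A *v u) * (\<Prod>j\<in>UNIV - {k}. K)"
    using bound[of "Q *v axis _ 1"] by (intro mult_left_mono prod_mono) (auto simp: col normQ)
  also have "\<dots> = K ^ (CARD('n) - 1) * norm (A *v u)"
    by (simp add: card_Diff_singleton)
  also have "A *v u = (A *v x) /\<^sub>R norm x"
    by (simp add: u_def scaleR_matrix_vector_assoc[symmetric] matrix_vector_mult_scaleR)
  finally show ?thesis using False by (simp add: field_simps)
qed simp

lemma matrix_inv_right_left:
  assumes "invertible A"
  shows "A ** matrix_inv A = mat 1" "matrix_inv A ** A = mat 1"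
  using someI_ex[OF assms[unfolded invertible_def]] unfolding matrix_inv_def by auto

lemma onorm_matrix_inv_le:
  fixes A :: "real ^ 'n ^ 'n"
  assumes "0 < c" and lower: "\<And>x. c * norm x \<le> norm (A *v x)"
  shows "invertible A" and "onorm ((*v) (matrix_inv A)) \<le> 1 / c"
proof -
  have "inj ((*v) A)"
  proof (rule linear_injective_0[THEN iffD2])
    show "\<forall>x. A *v x = 0 \<longrightarrow> x = 0"
      using lower \<open>0 < c\<close> by (metis mult_le_0_iff norm_le_zero_iff norm_zero not_le)
  qed simp
  then show inv: "invertible A"
    by (metis invertible_left_inverse matrix_left_invertible_injective)
  show "onorm ((*v) (matrix_inv A)) \<le> 1 / c"
  proof (rule onorm_le)
    fix y :: "real ^ 'n"
    have "c * norm (matrix_inv A *v y) \<le> norm y"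
      using lower[of "matrix_inv A *v y"]
      by (simp add: matrix_vector_mul_assoc matrix_inv_right_left[OF inv])
    then show "norm (matrix_inv A *v y) \<le> 1 / c * norm y"
      using \<open>0 < c\<close> by (simp add: field_simps)
  qed
qed

section \<open>Sets built by well separated insertions\<close>

text \<open>The invariant shared by both procedures. It is inductive because the distance condition
  refers to the order of insertion, which a plain set forgets.\<close>

inductive well_spread :: "real \<Rightarrow> real \<Rightarrow> (real ^ 'n) set \<Rightarrow> bool" for b c where
  zero: "well_spread b c {0}"
| insert: "well_spread b c D \<Longrightarrow> norm d \<le> b \<Longrightarrow> (\<And>p. p \<in> span D \<Longrightarrow> c \<le> norm (d - p)) \<Longrightarrow>
    well_spread b c (insert d D)"

text \<open>Zero is excluded because the base case does not constrain the sign of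
  \<open>b\<close>.\<close>

lemma well_spread_norm_le:
  assumes "well_spread b c D" "x \<in> D" "x \<noteq> 0"
  shows "norm x \<le> b"
  using assms by induction auto

lemma well_spread_finite: "well_spread b c D \<Longrightarrow> finite D"
  by (induction rule: well_spread.induct) auto

lemma well_spread_zero_mem: "well_spread b c D \<Longrightarrow> 0 \<in> D"
  by (induction rule: well_spread.induct) auto

text \<open>Recovers the order of insertion as a numbering. Positivity of \<open>c\<close> puts each
  inserted vector outside the previous span, so it is a new element and can be numbered above all
  others.\<close>

lemma well_spread_ordering:
  assumes "well_spread b c D" "0 < c"
  shows "\<exists>f :: real ^ 'n \<Rightarrow> nat. inj_on f D \<and>
    (\<forall>x\<in>D - {0}. \<forall>p\<in>span {y \<in> D. f y < f x}. c \<le> norm (x - p))"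
  using assms(1)
proof induction
  case zero
  then show ?case by auto
next
  case (insert D d)
  then obtain f :: "real ^ 'n \<Rightarrow> nat" where inj: "inj_on f D"
    and far: "\<And>x p. x \<in> D - {0} \<Longrightarrow> p \<in> span {y \<in> D. f y < f x} \<Longrightarrow> c \<le> norm (x - p)"
    by auto
  have "d \<notin> span D"
    using insert.hyps(3)[of d] \<open>0 < c\<close> by auto
  then have "d \<notin> D" using span_base by blast
  define g where "g = f(d := Suc (Max (f ` D)))"
  have g: "g x < g d" "g x = f x" if "x \<in> D" for x
    using that \<open>d \<notin> D\<close> well_spread_finite[OF insert.hyps(1)] by (auto simp: g_def less_Suc_eq_le)
  have "inj_on g D" using inj g(2) by (simp add: inj_on_def)
  then have "inj_on g (insert d D)" using g(1) by fastforce
  moreover have "c \<le> norm (x - p)"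
    if "x \<in> insert d D - {0}" "p \<in> span {y \<in> insert d D. g y < g x}" for x p
  proof (cases "x = d")
    case True
    have "{y \<in> insert d D. g y < g x} \<subseteq> D" using True by auto
    then show ?thesis using that span_mono True insert.hyps(3) by blast
  next
    case False
    then have "x \<in> D" using that by auto
    then have "{y \<in> insert d D. g y < g x} = {y \<in> D. f y < f x}"
      using g[OF \<open>x \<in> D\<close>] g(2) by auto
    then show ?thesis using that False far by auto
  qed
  ultimately show ?case by blast
qed

text \<open>Distances bound the determinant from below, norms bound the columns from above, and
  together they bound \<open>A *v x\<close> from below.\<close>

lemma well_spread_inverse_bound:
  fixes d :: "'n \<Rightarrow> real ^ 'n"
  assumes ws: "well_spread b c D" and "0 < c" and D: "D = insert 0 (range d)" "card D = CARD('n) + 1"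
  defines "A \<equiv> (\<chi> i j. d j $ i) :: real ^ 'n ^ 'n"
  shows "invertible A"
    and "onorm ((*v) (matrix_inv A)) \<le> (sqrt (real CARD('n)) * b) ^ (CARD('n) - 1) / c ^ CARD('n)"
proof -
  \<comment> \<open>The cardinality of \<open>D\<close> leaves room neither for a repetition among
    the \<open>d j\<close> nor for a zero vector.\<close>
  have card: "card (range d) \<ge> CARD('n)" 
    using D card_insert_le_m1[of "card D" "range d" 0] by (simp add: card_insert_if split: if_splits)
  then have "card (range d) = CARD('n)" using card_image_le[of UNIV d] by simp
  then have "inj d" by (simp add: eq_card_imp_inj_on)
  have nz: "d i \<noteq> 0" for i
  proof
    assume "d i = 0"
    then have "D = range d" using D by (metis insert_absorb rangeI)
    then show False using D \<open>card (range d) = _\<close> by simp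
  qed
  obtain f :: "real ^ 'n \<Rightarrow> nat" where inj: "inj_on f D"
    and far: "\<And>x p. x \<in> D - {0} \<Longrightarrow> p \<in> span {y \<in> D. f y < f x} \<Longrightarrow> c \<le> norm (x - p)"
    using well_spread_ordering[OF ws \<open>0 < c\<close>] by auto
  have col: "column j A = d j" for j by (simp add: A_def column_def vec_eq_iff)
  have norm_d: "norm (d j) \<le> b" for j
    using well_spread_norm_le[OF ws] nz D by simp
  have "b > 0" using norm_d nz by (metis less_le_trans zero_less_norm_iff)
  define K where "K = sqrt (real CARD('n)) * b"
  have "K > 0" using \<open>b > 0\<close> by (simp add: K_def)
  have K: "norm (A *v x) \<le> K * norm x" for x
    unfolding K_def by (rule norm_matrix_vector_le_columns) (simp add: col norm_d)
  have det: "c ^ CARD('n) \<le> \<bar>det (\<chi> i. d i)\<bar>"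
  proof (rule abs_det_ge_power[where f = "f \<circ> d"])
    show "inj (f \<circ> d)" using inj \<open>inj d\<close> D by (auto intro!: comp_inj_on inj_on_subset[OF inj])
    fix i p assume "p \<in> span (d ` {l. (f \<circ> d) l < (f \<circ> d) i})"
    moreover have "d ` {l. (f \<circ> d) l < (f \<circ> d) i} \<subseteq> {y \<in> D. f y < f (d i)}" using D by auto
    ultimately have "p \<in> span {y \<in> D. f y < f (d i)}" using span_mono by blast
    then show "c \<le> norm (d i - p)" using far nz D by auto
  qed (use \<open>0 < c\<close> in simp)
  \<comment> \<open>The determinant bound has the \<open>d i\<close> as rows, whereas they are the
    columns of \<open>A\<close>.\<close>
  have "(\<chi> i. d i) = transpose A" by (simp add: A_def transpose_def vec_eq_iff)
  then have det: "c ^ CARD('n) \<le> \<bar>det A\<bar>" using det by simp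
  define c' where "c' = c ^ CARD('n) / K ^ (CARD('n) - 1)"
  have "0 < c'" using \<open>0 < c\<close> \<open>K > 0\<close> by (simp add: c'_def)
  have lower: "c' * norm x \<le> norm (A *v x)" for x
  proof -
    have "c ^ CARD('n) * norm x \<le> K ^ (CARD('n) - 1) * norm (A *v x)"
      using norm_matrix_vector_ge_det[OF K] det by (meson mult_right_mono norm_ge_zero order_trans)
    then show ?thesis using \<open>K > 0\<close> by (simp add: c'_def field_simps)
  qed
  show "invertible A" by (rule onorm_matrix_inv_le(1)[OF \<open>0 < c'\<close> lower])
  show "onorm ((*v) (matrix_inv A)) \<le> (sqrt (real CARD('n)) * b) ^ (CARD('n) - 1) / c ^ CARD('n)"
    using onorm_matrix_inv_le(2)[OF \<open>0 < c'\<close> lower] by (simp add: c'_def K_def)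
qed

section \<open>Distances to a span, read off from its orthogonal complement\<close>

lemma orth_proj_props:
  fixes S :: "(real ^ 'n) set"
  assumes "subspace S"
  shows "orth_proj S x \<in> S" "x - orth_proj S x \<in> S\<^sup>\<bottom>"
  using theI'[OF orth_proj_ex1[OF assms, of x]] by (auto simp: orth_proj_def)

text \<open>\<open>x - p\<close> splits into the projection and a vector orthogonal to it. This
  turns the acceptance test of the selection into a distance estimate.\<close>

lemma norm_orth_proj_complement_le:
  fixes D :: "(real ^ 'n) set"
  assumes "complement_basis D Z" "p \<in> span D"
  shows "norm (proj_cols Z x) \<le> norm (x - p)"
proof -
  let ?S = "(span D)\<^sup>\<bottom>"
  have S: "span (set Z) = ?S" using assms by (simp add: complement_basis_def)
  have pr: "orth_proj ?S x \<in> ?S" "x - orth_proj ?S x \<in> ?S\<^sup>\<bottom>"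
    by (rule orth_proj_props[OF subspace_orthogonal_comp])+
  have "orthogonal (orth_proj ?S x) (x - orth_proj ?S x - p)"
    using orthogonal_clauses(5)[of "orth_proj ?S x" "x - orth_proj ?S x" p] pr assms(2)
    by (simp add: orthogonal_comp_def orthogonal_commute)
  from norm_add_Pythagorean[OF this] show ?thesis
    unfolding S by (simp add: power2_le_imp_le algebra_simps)
qed

text \<open>With \<open>s\<close> the projection of \<open>x\<close> onto the columns, the squared
  norm of \<open>x - s\<close> is the difference of the two sides.\<close>

lemma bessel_inequality:
  assumes "orthonormal_columns Z"
  shows "Upsilon Z x \<le> (norm x)\<^sup>2"
proof -
  have U: "Upsilon Z x = (\<Sum>i<length Z. (Z ! i \<bullet> x)\<^sup>2)"
    unfolding Upsilon_def by (simp add: sum_list_sum_nth atLeast0LessThan)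
  define s where "s = (\<Sum>i<length Z. (Z ! i \<bullet> x) *\<^sub>R Z ! i)"
  have xs: "x \<bullet> s = Upsilon Z x"
    unfolding U s_def by (simp add: inner_sum_right inner_commute power2_eq_square)
  have Zs: "Z ! j \<bullet> s = Z ! j \<bullet> x" if "j < length Z" for j
  proof -
    have "Z ! j \<bullet> s = (\<Sum>i<length Z. if i = j then Z ! i \<bullet> x else 0)"
      unfolding s_def inner_sum_right
      using assms that by (intro sum.cong) (auto simp: orthonormal_columns_def)
    then show ?thesis using that by simp
  qed
  have "s \<bullet> s = (\<Sum>i<length Z. (Z ! i \<bullet> x) * (Z ! i \<bullet> s))"
    by (subst s_def) (simp add: inner_sum_left)
  also have "\<dots> = Upsilon Z x" by (simp add: U Zs power2_eq_square)
  finally have "s \<bullet> s = Upsilon Z x" .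
  with xs have "(x - s) \<bullet> (x - s) = x \<bullet> x - Upsilon Z x"
    by (simp add: inner_diff_left inner_diff_right inner_commute)
  then show ?thesis using inner_ge_zero[of "x - s"] by (simp add: power2_norm_eq_inner)
qed

text \<open>The columns of \<open>Z\<close> are orthogonal to \<open>p\<close>, so subtracting
  \<open>p\<close> leaves \<open>Upsilon\<close> unchanged. A large objective value thus means a
  large distance to the span.\<close>

lemma Upsilon_le_norm_diff:
  assumes "complement_basis D Z" "p \<in> span D"
  shows "Upsilon Z x \<le> (norm (x - p))\<^sup>2"
proof -
  have "z \<bullet> p = 0" if "z \<in> set Z" for z
  proof -
    have "z \<in> (span D)\<^sup>\<bottom>"
      using assms(1) that span_base by (auto simp: complement_basis_def)
    then show ?thesis using assms(2) by (auto simp: orthogonal_comp_def orthogonal_def inner_commute)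
  qed
  then have "Upsilon Z x = Upsilon Z (x - p)"
    unfolding Upsilon_def by (intro arg_cong[where f = sum_list] map_cong) (auto simp: inner_diff_right)
  also have "\<dots> \<le> (norm (x - p))\<^sup>2"
    using assms(1) by (intro bessel_inequality) (simp add: complement_basis_def)
  finally show ?thesis .
qed

text \<open>Without columns, \<open>D\<close> would span the whole space; but one of its elements is
  zero, and the remaining ones are too few.\<close>

lemma complement_basis_nonempty:
  fixes D :: "(real ^ 'n) set"
  assumes "complement_basis D Z" "finite D" "0 \<in> D" "card D < CARD('n) + 1"
  shows "Z \<noteq> []"
proof
  assume "Z = []"
  then have S: "(span D)\<^sup>\<bottom> = {0}" using assms(1) by (simp add: complement_basis_def)
  have "span D = UNIV"
    using subspace_sum_orthogonal_comp[of "span D"] S by (simp add: set_plus_def)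
  then have "span (D - {0}) = UNIV" by simp
  then have "dim (UNIV :: (real^'n) set) \<le> card (D - {0})"
    using assms(2) by (metis dim_le_card finite_Diff order_refl)
  then have "CARD('n) \<le> card (D - {0})" by simp
  also have "card (D - {0}) = card D - 1" using assms(3) by (simp add: card_Diff_singleton)
  finally show False using assms(4) zero_less_card_finite[where 'a = 'n] by linarith
qed

lemma complement_basis_identity:
  assumes "distinct js" "set js = (UNIV :: 'n::finite set)"
  shows "complement_basis {0 :: real ^ 'n} (map (\<lambda>j. axis j 1) js)"
proof -
  have "orthonormal_columns (map (\<lambda>j. axis j 1 :: real ^ 'n) js)"
    using assms(1) by (auto simp: orthonormal_columns_def inner_axis_axis nth_eq_iff_index_eq)
  moreover have "span (set (map (\<lambda>j. axis j 1 :: real ^ 'n) js)) = UNIV"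
  proof -
    have "set (map (\<lambda>j. axis j 1 :: real ^ 'n) js) = Basis"
      using assms(2) by (auto simp: Basis_vec_def)
    then show ?thesis by simp
  qed
  moreover have "(span {0 :: real ^ 'n})\<^sup>\<bottom> = UNIV"
    by (auto simp: orthogonal_comp_def orthogonal_def)
  ultimately show ?thesis by (simp add: complement_basis_def)
qed

section \<open>Trust-region norms of steps, and the breakpoints\<close>

lemma ltr_norm_mono:
  fixes v w :: "real ^ 'n"
  assumes "0 < tr" "\<And>j. \<bar>v $ j\<bar> \<le> \<bar>w $ j\<bar>"
  shows "ltr_norm tr v \<le> ltr_norm tr w"
  unfolding ltr_norm_def using assms
  by (intro powr_mono2 sum_mono sum_nonneg) auto

lemma ltr_norm_zero: "ltr_norm tr (0 :: real ^ 'n) = 0"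
  by (simp add: ltr_norm_def)

lemma ltr_enorm_le_iff:
  "ltr_enorm tr w \<le> ereal r \<longleftrightarrow> (\<forall>j. \<bar>w $ j\<bar> \<noteq> \<infinity>) \<and> ltr_norm tr (real_vec w) \<le> r"
  by (auto simp: ltr_enorm_def)

lemma ltr_enorm_eq_iff:
  "ltr_enorm tr w = ereal r \<longleftrightarrow> (\<forall>j. \<bar>w $ j\<bar> \<noteq> \<infinity>) \<and> ltr_norm tr (real_vec w) = r"
  by (auto simp: ltr_enorm_def)

lemma real_vec_step_dir_nth:
  "real_vec (step_dir tb v \<tau>) $ j = real_of_ereal (min \<tau> (tb $ j)) * v $ j"
  by (simp add: real_vec_def step_dir_def)

lemma abs_step_dir_mono:
  assumes "0 \<le> s" "s \<le> t" "0 \<le> tb $ j"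
  shows "\<bar>step_dir tb v s $ j\<bar> \<le> \<bar>step_dir tb v t $ j\<bar>"
proof -
  have "0 \<le> min s (tb $ j)" "0 \<le> min t (tb $ j)" using assms by auto
  moreover have "min s (tb $ j) \<le> min t (tb $ j)" using assms by (intro min.mono) auto
  ultimately show ?thesis
    by (simp add: step_dir_def ereal_abs_mult ereal_mult_right_mono del: min.bounded_iff min_less_iff_conj)
qed

text \<open>Monotonicity holds in each component. Phrased with a finite bound \<open>r\<close>, it
  also transfers finiteness of the components from \<open>t\<close> to \<open>s\<close>.\<close>

lemma ltr_enorm_step_dir_mono:
  assumes "0 < tr" "\<And>j. 0 \<le> tb $ j" "0 \<le> s" "s \<le> t"
    and fin: "ltr_enorm tr (step_dir tb v t) \<le> ereal r"
  shows "ltr_enorm tr (step_dir tb v s) \<le> ereal r"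
proof -
  let ?w = "\<lambda>t. step_dir tb v t"
  have mono: "\<bar>?w s $ j\<bar> \<le> \<bar>?w t $ j\<bar>" for j
    using assms by (intro abs_step_dir_mono) auto
  have fin_t: "\<bar>?w t $ j\<bar> \<noteq> \<infinity>" for j using fin by (simp add: ltr_enorm_le_iff)
  have fin_s: "\<bar>?w s $ j\<bar> \<noteq> \<infinity>" for j using mono[of j] fin_t[of j] by auto
  have "ltr_norm tr (real_vec (?w s)) \<le> ltr_norm tr (real_vec (?w t))"
  proof (rule ltr_norm_mono[OF \<open>0 < tr\<close>])
    fix j
    obtain a b where "?w s $ j = ereal a" "?w t $ j = ereal b"
      using fin_s[of j] fin_t[of j] by (metis ereal_real)
    then show "\<bar>real_vec (?w s) $ j\<bar> \<le> \<bar>real_vec (?w t) $ j\<bar>"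
      using mono[of j] by (simp add: real_vec_def)
  qed
  then show ?thesis using fin fin_s by (auto simp: ltr_enorm_le_iff)
qed

lemma breakpoints_props:
  fixes tb :: "ereal ^ 'n"
  defines "n \<equiv> length (breakpoints tb) - 1"
  shows breakpoints_nonneg: "i \<le> n \<Longrightarrow> 0 \<le> breakpoints tb ! i"
    and breakpoints_mono: "i \<le> j \<Longrightarrow> j \<le> n \<Longrightarrow> breakpoints tb ! i \<le> breakpoints tb ! j"
    and breakpoints_last: "0 < tb $ l \<Longrightarrow> 0 < n \<and> tb $ l \<le> breakpoints tb ! n"
proof -
  let ?S = "{t \<in> range (($) tb). 0 < t}"
  have len: "length (breakpoints tb) = Suc n" by (simp add: n_def breakpoints_def)
  have sorted: "sorted (breakpoints tb)" by (auto simp: breakpoints_def)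
  show "i \<le> n \<Longrightarrow> 0 \<le> breakpoints tb ! i"
    using sorted_nth_mono[OF sorted, of 0 i] len by (simp add: breakpoints_def)
  show "i \<le> j \<Longrightarrow> j \<le> n \<Longrightarrow> breakpoints tb ! i \<le> breakpoints tb ! j"
    using sorted_nth_mono[OF sorted] len by simp
  assume "0 < tb $ l"
  then have "tb $ l \<in> set (sorted_list_of_set ?S)" by simp
  moreover have "length (sorted_list_of_set ?S) = n" using len by (simp only: breakpoints_def) simp
  ultimately obtain i where "i < n" "sorted_list_of_set ?S ! i = tb $ l"
    by (metis in_set_conv_nth)
  \<comment> \<open>The index shifts by one because of the leading breakpoint zero.\<close>
  then have i: "Suc i \<le> n" "breakpoints tb ! Suc i = tb $ l" by (auto simp: breakpoints_def)
  then show "0 < n \<and> tb $ l \<le> breakpoints tb ! n"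
    using sorted_nth_mono[OF sorted, of "Suc i" n] len by auto
qed

text \<open>Every candidate of the maximization is admissible: a breakpoint by monotonicity, the cut
  point by its choice.\<close>

lemma opt_step_enorm_le:
  fixes tb :: "ereal ^ 'n"
  assumes "opt_step tr \<Delta> Z v tb \<tau>" "0 < tr" "0 \<le> \<Delta>" "\<And>j. 0 \<le> tb $ j"
  shows "ltr_enorm tr (step_dir tb v \<tau>) \<le> ereal \<Delta>"
proof -
  let ?t = "\<lambda>i. breakpoints tb ! i" and ?n = "length (breakpoints tb) - 1"
  let ?N = "\<lambda>s. ltr_enorm tr (step_dir tb v s)"
  have mono: "?N (?t i) \<le> ereal \<Delta>" if "?N (?t j) \<le> ereal \<Delta>" "i \<le> j" "j \<le> ?n" for i j
    using that assms by (intro ltr_enorm_step_dir_mono[of tr tb "?t i" "?t j"])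
      (auto intro: breakpoints_nonneg breakpoints_mono)
  consider (none) "\<tau> = 0"
    | (all) "?N (?t ?n) \<le> ereal \<Delta>" "\<tau> \<in> ?t ` {1..?n}"
    | (cut) j \<tau>' where "j \<in> {1..?n}" "?N (?t (j - 1)) \<le> ereal \<Delta>" "?N \<tau>' = ereal \<Delta>"
       "\<tau> \<in> ?t ` {1..j - 1} \<union> {\<tau>'}"
    using assms(1) unfolding opt_step_def Let_def is_arg_max_def
    by (auto split: if_splits)
  then show ?thesis
  proof cases
    case none
    have "step_dir tb v 0 = 0"
      using assms(4) by (simp add: step_dir_def vec_eq_iff min_absorb1)
    then show ?thesis using none \<open>0 \<le> \<Delta>\<close>
      by (simp add: ltr_enorm_le_iff real_vec_def ltr_norm_def)
  next
    case all
    then show ?thesis using mono by auto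
  next
    case cut
    then show ?thesis using mono[OF cut(2)] by auto
  qed
qed

section \<open>Lower bounds for a single step\<close>

lemma taubar_nonneg:
  assumes "xk \<in> feasible_box xL xU"
  shows "0 \<le> taubar xL xU xk v $ j"
proof -
  have "xL $ j \<le> ereal (xk $ j)" "ereal (xk $ j) \<le> xU $ j"
    using assms by (auto simp: feasible_box_def)
  then show ?thesis
    by (cases "xL $ j"; cases "xU $ j") (auto simp: taubar_def divide_nonpos_neg)
qed

text \<open>If \<open>\<tau>\<close> lies below the \<open>j\<close>-th bound then no component of $d(v,\tau)$ exceeds $\tau |v_i|$, so
  the norm of the step bounds $\tau$ from below; otherwise component \<open>j\<close> has reached its bound.\<close>

lemma step_dir_inner_ge:
  fixes v :: "real ^ 'n" and tb :: "ereal ^ 'n"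
  assumes "norm v = 1" and vj: "1 \<le> real CARD('n) * (v $ j)\<^sup>2"
    and tb: "\<And>i. 0 \<le> tb $ i" and "0 \<le> \<tau>"
    and fin: "\<And>i. \<bar>step_dir tb v \<tau> $ i\<bar> \<noteq> \<infinity>"
    and bound: "ereal (real CARD('n) * c) \<le> tb $ j * ereal \<bar>v $ j\<bar>" and "0 < c"
    and long: "\<tau> < tb $ j \<Longrightarrow> real CARD('n) * c \<le> norm (real_vec (step_dir tb v \<tau>))"
  shows "c \<le> v \<bullet> real_vec (step_dir tb v \<tau>)"
proof -
  let ?n = "real CARD('n)"
  define m where "m i = real_of_ereal (min \<tau> (tb $ i))" for i
  have m0: "0 \<le> m i" for i using tb \<open>0 \<le> \<tau>\<close> by (simp add: m_def real_of_ereal_pos)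
  have e: "real_vec (step_dir tb v \<tau>) $ i = m i * v $ i" for i
    by (simp add: real_vec_step_dir_nth m_def)
  have "v $ j \<noteq> 0" using vj by auto
  have "?n \<ge> 1" by (simp add: Suc_le_eq)
  have inner: "m j * (v $ j)\<^sup>2 \<le> v \<bullet> real_vec (step_dir tb v \<tau>)"
  proof -
    have "m j * (v $ j)\<^sup>2 \<le> (\<Sum>i\<in>UNIV. m i * (v $ i)\<^sup>2)"
      using m0 by (intro member_le_sum) auto
    then show ?thesis by (simp add: inner_vec_def e power2_eq_square mult_ac)
  qed
  have vj_le: "\<bar>v $ j\<bar> \<le> 1" using component_le_norm_cart[of v j] \<open>norm v = 1\<close> by simp
  \<comment> \<open>The factor \<open>?n\<close> is kept so that the choice of \<open>j\<close>,
    which makes \<open>?n * (v $ j)\<^sup>2\<close> at least one, can absorb it.\<close>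
  have "?n * c \<le> ?n * (m j * (v $ j)\<^sup>2)"
  proof (cases "\<tau> < tb $ j")
    case True
    then obtain t where t: "\<tau> = ereal t" using \<open>0 \<le> \<tau>\<close> by (cases \<tau>) auto
    have mj: "m j = t" using True t by (simp add: m_def min_absorb1)
    have "norm (real_vec (step_dir tb v \<tau>)) \<le> norm (t *\<^sub>R v)"
    proof (rule norm_le_componentwise_cart)
      fix i
      have "m i \<le> t" using t tb[of i] \<open>0 \<le> \<tau>\<close> real_of_ereal_positive_mono[of "min \<tau> (tb $ i)" \<tau>]
        by (auto simp: m_def)
      then show "norm (real_vec (step_dir tb v \<tau>) $ i) \<le> norm ((t *\<^sub>R v) $ i)"
        using m0[of i] by (simp add: e abs_mult mult_right_mono)
    qed
    also have "\<dots> = t" using \<open>norm v = 1\<close> t \<open>0 \<le> \<tau>\<close> by simp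
    finally have "?n * c \<le> t" using long True by simp
    also have "t \<le> t * (?n * (v $ j)\<^sup>2)" using vj t \<open>0 \<le> \<tau>\<close> by (simp add: mult_le_cancel_left1)
    finally show ?thesis by (simp add: mj mult_ac)
  next
    case False
    then have "step_dir tb v \<tau> $ j = tb $ j * ereal (v $ j)" by (simp add: step_dir_def min_def)
    \<comment> \<open>An infinite bound that is reached would make this component of the step
      infinite.\<close>
    with fin[of j] \<open>v $ j \<noteq> 0\<close> obtain t where t: "tb $ j = ereal t"
      by (cases "tb $ j") (auto split: if_splits)
    have mj: "m j = t" using False t by (simp add: m_def min_def)
    have nc: "?n * c \<le> m j * \<bar>v $ j\<bar>" using bound t mj by simp
    have "\<bar>v $ j\<bar> \<le> ?n * (v $ j)\<^sup>2" using vj vj_le by linarith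
    then have "m j * \<bar>v $ j\<bar> \<le> m j * (?n * (v $ j)\<^sup>2)"
      using m0 by (intro mult_left_mono) auto
    then have "?n * c \<le> m j * (?n * (v $ j)\<^sup>2)" using nc by linarith
    then show ?thesis by (simp only: mult.left_commute)
  qed
  then have "c \<le> m j * (v $ j)\<^sup>2" by simp
  then show ?thesis using inner by linarith
qed

text \<open>The longest candidate already has inner product at least \<open>c\<close> with
  \<open>v\<close>, whose square is one summand of \<open>Upsilon\<close>; the maximizer can only do
  better.\<close>

lemma opt_step_Upsilon_ge:
  fixes v :: "real ^ 'n" and tb :: "ereal ^ 'n"
  assumes opt: "opt_step tr \<Delta> Z v tb \<tau>"
    and "norm v = 1" and vj: "1 \<le> real CARD('n) * (v $ j)\<^sup>2"
    and tb: "\<And>i. 0 \<le> tb $ i"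
    and bound: "ereal (real CARD('n) * c) \<le> tb $ j * ereal \<bar>v $ j\<bar>" and "0 < c"
    and long: "\<And>w :: real ^ 'n. ltr_norm tr w = \<Delta> \<Longrightarrow> real CARD('n) * c \<le> norm w"
    and "z \<in> set Z" "v = z \<or> v = - z"
  shows "c\<^sup>2 \<le> Upsilon Z (real_vec (step_dir tb v \<tau>))"
proof -
  let ?t = "\<lambda>i. breakpoints tb ! i" and ?n = "length (breakpoints tb) - 1"
  let ?U = "\<lambda>s. Upsilon Z (real_vec (step_dir tb v s))"
  have "tb $ j \<noteq> 0"
  proof
    assume "tb $ j = 0"
    then show False using bound \<open>0 < c\<close> by (simp add: zero_ereal_def mult_le_0_iff)
  qed
  then have "0 < tb $ j" using tb[of j] by (simp add: order.strict_iff_order)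
  from breakpoints_last[OF this] have n: "0 < ?n" "tb $ j \<le> ?t ?n" by auto
  have inner_U: "c\<^sup>2 \<le> Upsilon Z w" if "c \<le> v \<bullet> w" for w
  proof -
    have "c\<^sup>2 \<le> (v \<bullet> w)\<^sup>2" using that \<open>0 < c\<close> by (intro power_mono) auto
    also have "\<dots> = (z \<bullet> w)\<^sup>2" using assms(9) by auto
    also have "\<dots> \<le> Upsilon Z w"
      unfolding Upsilon_def using \<open>z \<in> set Z\<close> by (intro member_le_sum_list) auto
    finally show ?thesis .
  qed
  have arg: "?U s \<le> ?U \<tau>" if "is_arg_max ?U (\<lambda>s. s \<in> T) \<tau>" "s \<in> T" for s T
    using that by (auto simp: is_arg_max_def not_less)
  show ?thesis
  proof (cases "ltr_enorm tr (step_dir tb v (?t ?n)) \<le> ereal \<Delta>")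
    case True
    then have am: "is_arg_max ?U (\<lambda>s. s \<in> ?t ` {1..?n}) \<tau>"
      using opt n unfolding opt_step_def Let_def by simp
    \<comment> \<open>The last breakpoint is at least \<open>tb $ j\<close>, so only the case of a
      reached bound occurs.\<close>
    have "c \<le> v \<bullet> real_vec (step_dir tb v (?t ?n))"
      using True n \<open>0 < c\<close> bound tb assms(2) vj
      by (intro step_dir_inner_ge[where j = j]) (auto simp: ltr_enorm_le_iff intro: breakpoints_nonneg)
    then have "c\<^sup>2 \<le> ?U (?t ?n)" by (rule inner_U)
    also have "\<dots> \<le> ?U \<tau>" using n by (intro arg[OF am]) auto
    finally show ?thesis .
  next
    case False
    then obtain i \<tau>' where i: "i \<in> {1..?n}" "?t (i - 1) \<le> \<tau>'"
      and len: "ltr_enorm tr (step_dir tb v \<tau>') = ereal \<Delta>"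
      and am: "is_arg_max ?U (\<lambda>s. s \<in> ?t ` {1..i - 1} \<union> {\<tau>'}) \<tau>"
      using opt n unfolding opt_step_def Let_def by (auto split: if_splits)
    have "0 \<le> ?t (i - 1)" using i by (intro breakpoints_nonneg) auto
    then have "0 \<le> \<tau>'" using i by simp
    \<comment> \<open>The cut step has norm exactly \<Delta>, so \<open>long\<close> covers the case
      that coordinate \<open>j\<close> has not reached its bound.\<close>
    then have "c \<le> v \<bullet> real_vec (step_dir tb v \<tau>')"
      using len \<open>0 < c\<close> bound tb assms(2) vj
      by (intro step_dir_inner_ge[where j = j]) (auto simp: ltr_enorm_eq_iff intro: long)
    then have "c\<^sup>2 \<le> ?U \<tau>'" by (rule inner_U)
    also have "\<dots> \<le> ?U \<tau>" by (intro arg[OF am]) auto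
    finally show ?thesis .
  qed
qed

section \<open>The loop over the columns of \<open>Z\<close>\<close>

lemma direction_loop_invariant:
  assumes step: "\<And>z d d'. z \<in> set zs \<Longrightarrow> P d \<Longrightarrow>
      try_direction xL xU xk tr \<Delta> Z z d d' \<or> try_direction xL xU xk tr \<Delta> Z (- z) d d' \<Longrightarrow> P d'"
    and "direction_loop xL xU xk tr \<Delta> Z zs d d'" "P d"
  shows "P d'"
  using assms(2,3,1)
proof (induction zs arbitrary: d)
  case (Cons z zs)
  from Cons.prems(1) obtain d1 d2 where
    t: "try_direction xL xU xk tr \<Delta> Z z d d1" "try_direction xL xU xk tr \<Delta> Z (- z) d1 d2"
    and l: "direction_loop xL xU xk tr \<Delta> Z zs d2 d'" by auto
  have "P d1" using Cons.prems(3)[of z d d1] Cons.prems(2) t by auto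
  then have "P d2" using Cons.prems(3)[of z d1 d2] t by auto
  then show ?case using Cons.IH[OF l] Cons.prems(3) by (meson list.set_intros(2))
qed simp

lemma try_direction_Upsilon_mono:
  "try_direction xL xU xk tr \<Delta> Z v d d' \<Longrightarrow> Upsilon Z d \<le> Upsilon Z d'"
  by (auto simp: try_direction_def Let_def)

lemma try_direction_ltr_norm_le:
  assumes "try_direction xL xU xk tr \<Delta> Z v d d'" "ltr_norm tr d \<le> \<Delta>"
    and "xk \<in> feasible_box xL xU" "0 < tr" "0 \<le> \<Delta>"
  shows "ltr_norm tr d' \<le> \<Delta>"
proof -
  obtain \<tau> where \<tau>: "opt_step tr \<Delta> Z v (taubar xL xU xk v) \<tau>"
    and d': "d' = d \<or> d' = real_vec (step_dir (taubar xL xU xk v) v \<tau>)"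
    using assms(1) by (auto simp: try_direction_def Let_def)
  have "ltr_enorm tr (step_dir (taubar xL xU xk v) v \<tau>) \<le> ereal \<Delta>"
    using \<tau> assms by (intro opt_step_enorm_le) (auto intro: taubar_nonneg)
  then show ?thesis using d' assms(2) by (auto simp: ltr_enorm_le_iff)
qed

text \<open>Since $x_k$ lies in the box, one of the two opposite moves along coordinate \<open>j\<close> has room for half
  the width of the box.\<close>

lemma taubar_half_width:
  fixes z :: "real ^ 'n"
  assumes "xk \<in> feasible_box xL xU" "z $ j \<noteq> 0" "ereal (2 * w) \<le> xU $ j - xL $ j"
    and "xL $ j \<noteq> \<infinity>" "xU $ j \<noteq> -\<infinity>"
  obtains v where "v = z \<or> v = - z"
    "ereal w \<le> taubar xL xU xk v $ j * ereal \<bar>v $ j\<bar>"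
proof -
  have box: "xL $ j \<le> ereal (xk $ j)" "ereal (xk $ j) \<le> xU $ j"
    using assms(1) by (auto simp: feasible_box_def)
  have up: "ereal w \<le> taubar xL xU xk v $ j * ereal \<bar>v $ j\<bar>"
    if "0 < v $ j" "ereal (xk $ j + w) \<le> xU $ j" for v
    using that by (cases "xU $ j") (auto simp: taubar_def)
  have down: "ereal w \<le> taubar xL xU xk v $ j * ereal \<bar>v $ j\<bar>"
    if "v $ j < 0" "xL $ j \<le> ereal (xk $ j - w)" for v
    using that by (cases "xL $ j") (auto simp: taubar_def)
  have pos_neg: "\<exists>v. (v = z \<or> v = - z) \<and> 0 < v $ j" "\<exists>v. (v = z \<or> v = - z) \<and> v $ j < 0"
    using \<open>z $ j \<noteq> 0\<close> by (metis linorder_neqE_linordered_idom neg_0_less_iff_less vector_uminus_component,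
      metis linorder_neqE_linordered_idom neg_less_0_iff_less vector_uminus_component)
  \<comment> \<open>If both moves failed, the box would be narrower than \<open>2 * w\<close>; an
    infinite bound always leaves room.\<close>
  have "ereal (xk $ j + w) \<le> xU $ j \<or> xL $ j \<le> ereal (xk $ j - w)"
    using assms(3,4,5) box by (cases "xU $ j"; cases "xL $ j") auto
  then show thesis using that pos_neg up down by metis
qed

text \<open>The squared coordinates of a unit vector sum to one, so some square is at least the
  average.\<close>

lemma ex_large_coordinate:
  fixes z :: "real ^ 'n"
  assumes "norm z = 1"
  obtains j where "1 \<le> real CARD('n) * (z $ j)\<^sup>2"
proof (rule ccontr)
  assume "\<not> thesis"
  then have "real CARD('n) * (z $ j)\<^sup>2 < 1" for j using that by (meson not_le)
  then have "(\<Sum>j\<in>(UNIV::'n set). real CARD('n) * (z $ j)\<^sup>2) < (\<Sum>j\<in>(UNIV::'n set). 1)"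
    by (intro sum_strict_mono) auto
  moreover have "(\<Sum>j\<in>UNIV. (z $ j)\<^sup>2) = 1"
    using assms by (simp add: norm_eq_1 inner_vec_def power2_eq_square)
  ultimately show False by (simp flip: sum_distrib_left)
qed

text \<open>The first column suffices: one of its two signs reaches the bound, and later tries never
  lower \<open>Upsilon\<close>.\<close>

lemma direction_loop_Upsilon_ge:
  fixes xL xU :: "ereal ^ 'n" and Z :: "(real ^ 'n) list"
  assumes loop: "direction_loop xL xU xk tr \<Delta> Z Z 0 d" and "Z \<noteq> []"
    and "orthonormal_columns Z"
    and box: "xk \<in> feasible_box xL xU" "\<And>j. xL $ j \<noteq> \<infinity>" "\<And>j. xU $ j \<noteq> -\<infinity>"
    and width: "\<And>j. ereal (2 * (real CARD('n) * c)) \<le> xU $ j - xL $ j" and "0 < c"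
    and long: "\<And>w :: real ^ 'n. ltr_norm tr w = \<Delta> \<Longrightarrow> real CARD('n) * c \<le> norm w"
  shows "c\<^sup>2 \<le> Upsilon Z d"
proof -
  obtain z zs where Z: "Z = z # zs" using \<open>Z \<noteq> []\<close> by (cases Z) auto
  have "z \<bullet> z = 1" using \<open>orthonormal_columns Z\<close> by (force simp: orthonormal_columns_def Z)
  then have nz: "norm z = 1" by (simp add: norm_eq_1)
  then obtain j where j: "1 \<le> real CARD('n) * (z $ j)\<^sup>2" by (rule ex_large_coordinate)
  then have "z $ j \<noteq> 0" by auto
  then obtain v where v: "v = z \<or> v = - z"
    and bound: "ereal (real CARD('n) * c) \<le> taubar xL xU xk v $ j * ereal \<bar>v $ j\<bar>"
    using taubar_half_width[OF box(1) _ width[of j] box(2,3)] by metis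
  have nv: "norm v = 1" and vj: "1 \<le> real CARD('n) * (v $ j)\<^sup>2" using v nz j by auto
  have reach: "c\<^sup>2 \<le> Upsilon Z d'" if "try_direction xL xU xk tr \<Delta> Z v d0 d'" for d0 d'
  proof -
    from that obtain \<tau> where \<tau>: "opt_step tr \<Delta> Z v (taubar xL xU xk v) \<tau>"
      and le: "Upsilon Z (real_vec (step_dir (taubar xL xU xk v) v \<tau>)) \<le> Upsilon Z d'"
      by (auto simp: try_direction_def Let_def)
    have "c\<^sup>2 \<le> Upsilon Z (real_vec (step_dir (taubar xL xU xk v) v \<tau>))"
      by (rule opt_step_Upsilon_ge[OF \<tau> nv vj _ bound \<open>0 < c\<close> long _ v])
        (auto simp: Z intro: taubar_nonneg[OF box(1)])
    with le show ?thesis by simp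
  qed
  obtain d1 d2 where t: "try_direction xL xU xk tr \<Delta> Z z 0 d1"
    "try_direction xL xU xk tr \<Delta> Z (- z) d1 d2"
    and l: "direction_loop xL xU xk tr \<Delta> Z zs d2 d"
    using loop unfolding Z by auto
  have "c\<^sup>2 \<le> Upsilon Z d2"
    using v reach t try_direction_Upsilon_mono[OF t(2)] order_trans by blast
  then show ?thesis
    by (rule direction_loop_invariant[where P = "\<lambda>d. c\<^sup>2 \<le> Upsilon Z d", OF _ l, rotated])
      (use try_direction_Upsilon_mono order_trans in blast)
qed

section \<open>The invariant along both procedures and the final bound\<close>

lemma select_loop_well_spread:
  fixes xk :: "real ^ 'n"
  assumes "select_loop xk \<Delta> \<xi> C (D, Z) (D', Z')" "well_spread b (\<xi> * \<Delta>) D" "complement_basis D Z"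
    and "0 < \<Delta>" "\<And>x. x \<in> set C \<Longrightarrow> norm (x - xk) \<le> b"
  shows "well_spread b (\<xi> * \<Delta>) D' \<and> complement_basis D' Z'"
  using assms
proof (induction C arbitrary: D Z)
  case (Cons x xs)
  show ?case
  proof (cases "norm (proj_cols Z ((x - xk) /\<^sub>R \<Delta>)) \<ge> \<xi>")
    case True
    then obtain Z1 where Z1: "complement_basis (insert (x - xk) D) Z1"
      and l: "select_loop xk \<Delta> \<xi> xs (insert (x - xk) D, Z1) (D', Z')"
      using Cons.prems(1) by auto
    have "well_spread b (\<xi> * \<Delta>) (insert (x - xk) D)"
    proof (rule well_spread.insert[OF Cons.prems(2)])
      show "norm (x - xk) \<le> b" using Cons.prems(5) by simp
      fix p assume "p \<in> span D"
      \<comment> \<open>The test concerns the scaled vector, so \<open>p\<close> is scaled as well;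
        it stays in the span.\<close>
      then have "norm (proj_cols Z ((x - xk) /\<^sub>R \<Delta>)) \<le> norm ((x - xk) /\<^sub>R \<Delta> - p /\<^sub>R \<Delta>)"
        by (intro norm_orth_proj_complement_le[OF Cons.prems(3)] span_mul)
      with True have "\<xi> \<le> norm ((x - xk - p) /\<^sub>R \<Delta>)"
        by (simp only: scaleR_diff_right)
      then have "\<xi> \<le> norm (x - xk - p) / \<Delta>" using \<open>0 < \<Delta>\<close> by (simp only: norm_scaleR) (simp add: field_simps)
      then show "\<xi> * \<Delta> \<le> norm (x - xk - p)" using \<open>0 < \<Delta>\<close> by (simp only: pos_le_divide_eq)
    qed
    then show ?thesis using Cons.IH[OF l] Z1 Cons.prems by simp
  next
    case False
    then show ?thesis using Cons by simp
  qed
qed simp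

theorem theorem3p7:
  fixes xL xU :: "ereal ^ 'n" and xk :: "real ^ 'n"
    and \<Delta> \<Delta>max tr \<kappa>0 \<kappa>1 \<xi> :: real
    and C Z0 Z :: "(real ^ 'n) list" and D0 D :: "(real ^ 'n) set"
    and d :: "'n \<Rightarrow> real ^ 'n"
  assumes "\<And>j. xL $ j \<noteq> \<infinity>" and "\<And>j. xU $ j \<noteq> -\<infinity>" and "\<And>j. xL $ j < xU $ j"
    and "xk \<in> feasible_box xL xU"
    and "0 < \<Delta>" and "\<Delta> \<le> \<Delta>max"
    and "1 \<le> tr"
    and "0 < \<kappa>0" and "\<And>v :: real ^ 'n. norm v \<le> \<kappa>0 * ltr_norm tr v"
    and "0 < \<kappa>1" and "\<And>v :: real ^ 'n. ltr_norm tr v \<le> \<kappa>1 * norm v"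
    and "0 < \<xi>"
    and "ereal \<xi> \<le> ereal (1 / real CARD('n)) *
           min (ereal (1 / \<kappa>1)) (Min (range (\<lambda>j. xU $ j - xL $ j)) / ereal (2 * \<Delta>max))"
    and "distinct C" and "set C \<subseteq> ltr_cball tr xk \<Delta> \<inter> feasible_box xL xU"
    and "select_points xk \<Delta> \<xi> C (D0, Z0)"
    and "(add_direction xL xU xk tr \<Delta>)\<^sup>*\<^sup>* (D0, Z0) (D, Z)"
    and "D = insert 0 (range d)" and "card D = CARD('n) + 1"
  shows "let A = (\<chi> i j. d j $ i) :: real ^ 'n ^ 'n;
             \<Lambda> = real CARD('n) powr ((real CARD('n) - 1) / 2) * \<kappa>0 ^ (CARD('n) - 1) / \<xi> ^ CARD('n)
         in invertible A \<and> onorm ((*v) (matrix_inv A)) \<le> \<Lambda> / \<Delta>"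
proof -
  let ?n = "real CARD('n)" and ?b = "\<kappa>0 * \<Delta>" and ?c = "\<xi> * \<Delta>"
  have n: "?n > 0" by simp
  have c: "0 < ?c" using assms by simp
  have norm_le: "norm v \<le> ?b" if "ltr_norm tr v \<le> \<Delta>" for v :: "real ^ 'n"
    using assms(9)[of v] that \<open>0 < \<kappa>0\<close> by (meson mult_left_mono less_imp_le order_trans)
  let ?m = "min (ereal (1 / \<kappa>1)) (Min (range (\<lambda>j. xU $ j - xL $ j)) / ereal (2 * \<Delta>max))"
  have \<xi>: "ereal (?n * \<xi>) \<le> ?m"
  proof -
    have "ereal ?n * ereal \<xi> \<le> ereal ?n * (ereal (1 / ?n) * ?m)"
      using assms(13) by (intro ereal_mult_left_mono) auto
    also have "\<dots> = ?m" using n by (simp add: mult.assoc[symmetric] one_ereal_def[symmetric])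
    finally show ?thesis by simp
  qed
  \<comment> \<open>The first term of the minimum bounding \<xi> handles steps stopped by the trust
    region.\<close>
  have long: "?n * ?c \<le> norm w" if "ltr_norm tr w = \<Delta>" for w :: "real ^ 'n"
  proof -
    have "?n * \<xi> \<le> 1 / \<kappa>1" using \<xi> by simp
    then have "?n * \<xi> * \<kappa>1 \<le> 1" using \<open>0 < \<kappa>1\<close> by (simp add: field_simps)
    then have "?n * \<xi> * \<kappa>1 * norm w \<le> norm w" by (intro mult_left_le_one_le) (use assms in auto)
    moreover have "?n * \<xi> * \<Delta> \<le> ?n * \<xi> * (\<kappa>1 * norm w)"
      using assms(11)[of w] that assms(12) by (intro mult_left_mono) auto
    ultimately show ?thesis by (simp add: mult_ac)
  qed
  \<comment> \<open>The second term handles steps stopped by the box; the factor 2 allows for the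
    half width, and \<Delta> is replaced by its upper bound \<open>\<Delta>max\<close>.\<close>
  have width: "ereal (2 * (?n * ?c)) \<le> xU $ j - xL $ j" for j
  proof -
    have "0 < \<Delta>max" using assms by linarith
    have "ereal (?n * \<xi>) \<le> Min (range (\<lambda>j. xU $ j - xL $ j)) / ereal (2 * \<Delta>max)"
      using \<xi> by simp
    then have "ereal (2 * \<Delta>max) * ereal (?n * \<xi>) \<le> Min (range (\<lambda>j. xU $ j - xL $ j))"
      using \<open>0 < \<Delta>max\<close> by (subst (asm) ereal_le_divide_pos) auto
    also have "\<dots> \<le> xU $ j - xL $ j" by (intro Min_le) auto
    finally have "ereal (2 * \<Delta>max * (?n * \<xi>)) \<le> xU $ j - xL $ j" by simp
    moreover have "2 * (?n * ?c) \<le> 2 * \<Delta>max * (?n * \<xi>)"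
      using assms(6,12) n by (simp add: mult_ac mult_left_mono)
    ultimately show ?thesis by (meson ereal_less_eq(3) order_trans)
  qed
  obtain js :: "'n list" where js: "distinct js" "set js = UNIV"
    and sel: "select_loop xk \<Delta> \<xi> C ({0}, map (\<lambda>j. axis j 1) js) (D0, Z0)"
    using assms(16) by (auto simp: select_points_def)
  have "well_spread ?b ?c D0 \<and> complement_basis D0 Z0"
  proof (rule select_loop_well_spread[OF sel well_spread.zero complement_basis_identity[OF js] assms(5)])
    fix x assume "x \<in> set C"
    then show "norm (x - xk) \<le> ?b"
      using assms(15) by (intro norm_le) (auto simp: ltr_cball_def)
  qed
  then have "well_spread ?b ?c (fst (D0, Z0)) \<and> complement_basis (fst (D0, Z0)) (snd (D0, Z0))" by simp
  with assms(17) have "well_spread ?b ?c (fst (D, Z)) \<and> complement_basis (fst (D, Z)) (snd (D, Z))"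
  proof (induction rule: rtranclp_induct)
    case (step S S')
    obtain E Y E' Y' where S: "S = (E, Y)" "S' = (E', Y')" by fastforce
    obtain e where card: "card E < CARD('n) + 1"
      and loop: "direction_loop xL xU xk tr \<Delta> Y Y 0 e"
      and E': "E' = insert e E" and Y': "complement_basis E' Y'"
      using step.hyps(2) unfolding S by auto
    have ws: "well_spread ?b ?c E" and cb: "complement_basis E Y"
      using step.IH step.prems S by auto
    have "Y \<noteq> []"
      using complement_basis_nonempty[OF cb] well_spread_finite[OF ws] well_spread_zero_mem[OF ws] card by simp
    then have U: "?c\<^sup>2 \<le> Upsilon Y e"
      using cb assms(1,2,4) c long width
      by (intro direction_loop_Upsilon_ge[OF loop]) (auto simp: complement_basis_def)
    have "ltr_norm tr e \<le> \<Delta>"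
      using assms(4,5,7)
      by (intro direction_loop_invariant[where P = "\<lambda>d. ltr_norm tr d \<le> \<Delta>", OF _ loop])
        (auto simp: ltr_norm_zero intro: try_direction_ltr_norm_le)
    moreover have "?c \<le> norm (e - p)" if "p \<in> span E" for p
      using order_trans[OF U Upsilon_le_norm_diff[OF cb that]] by (rule power2_le_imp_le) simp
    ultimately have "well_spread ?b ?c E'"
      unfolding E' using ws norm_le by (intro well_spread.insert) auto
    then show ?case using Y' S by simp
  qed
  then have ws: "well_spread ?b ?c D" by simp
  have "(sqrt ?n * ?b) ^ (CARD('n) - 1) / ?c ^ CARD('n)
    = sqrt ?n ^ (CARD('n) - 1) * \<kappa>0 ^ (CARD('n) - 1) / \<xi> ^ CARD('n) / \<Delta>"
  proof -
    \<comment> \<open>All factors \<Delta> but one cancel against the numerator.\<close>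
    have "\<Delta> ^ CARD('n) = \<Delta> * \<Delta> ^ (CARD('n) - 1)"
      by (metis power_minus_mult mult.commute zero_less_card_finite)
    then have "?c ^ CARD('n) = \<xi> ^ CARD('n) * \<Delta> * \<Delta> ^ (CARD('n) - 1)"
      by (simp only: power_mult_distrib mult.assoc)
    then show ?thesis using assms(5) by (subst \<open>?c ^ _ = _\<close>) (simp add: power_mult_distrib)
  qed
  also have "sqrt ?n ^ (CARD('n) - 1) = (?n powr (1 / 2)) powr real (CARD('n) - 1)"
    using n by (simp only: powr_half_sqrt powr_realpow real_sqrt_gt_zero less_imp_le)
  also have "\<dots> = ?n powr ((?n - 1) / 2)"
    by (simp add: powr_powr Suc_le_eq)
  finally show ?thesis
    using well_spread_inverse_bound[OF ws c assms(18,19)] by (simp add: Let_def)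
qed

end
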